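(* Let $W$ be a tournament limit. If $t(C_3,W)\ge 1/32$, then $t(C_4,W)\ge g(t(C_3,W))$, and equality $t(C_4,W)=g(t(C_3,W))$ holds if and only if there exists a measurable function $f:[0,1]\to[0,1/2]$ such that $W(x,y)=1/2+f(x)-f(y)$ for almost every $(x,y)\in[0,1]^2$.
   Context: A tournament limit is a measurable function $W:[0,1]^2\to[0,1]$ such that $W(x,y)+W(y,x)=1$ for all $(x,y)\in[0,1]^2$. For $\ell\ge 3$, the density of the directed cycle $C_\ell$ in $W$ is $$t(C_\ell,W)=\int_{[0,1]^\ell}W(x_1,x_2)W(x_2,x_3)\cdots W(x_{\ell-1},x_\ell)W(x_\ell,x_1)\,dx_1\cdots dx_\ell .$$ Every tournament limit satisfies $0\le t(C_3,W)\le 1/8$. The function $g:[0,1/8]\to[0,1]$ is defined by $g(0)=0$ and, for $z\in(0,1]$, $$g\left(\tfrac18\left(\lfloor z^{-1}\rfloor z^3+(1-\lfloor z^{-1}\rfloor z)^3\right)\right)=\tfrac1{16}\left(\lfloor z^{-1}\rfloor z^4+(1-\lfloor z^{-1}\rfloor z)^4\right);$$ this is well defined because $z\mapsto\frac18\left(\lfloor z^{-1}\rfloor z^3+(1-\lfloor z^{-1}\rfloor z)^3\right)$ is a bijection from $(0,1]$ onto $(0,1/8]$. *)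

theory Defs
  imports "HOL-Analysis.Analysis"
begin

text \<open>
  A function on the unit square is represented by a total function on the plane; its values outside
  the square are never used. ``Measurable'' means Lebesgue measurable.
\<close>

definition tournament_limit :: "(real \<times> real \<Rightarrow> real) \<Rightarrow> bool" where
  "tournament_limit W \<longleftrightarrow>
     W \<in> borel_measurable (lebesgue_on ({0..1} \<times> {0..1})) \<and>
     (\<forall>x\<in>{0..1}. \<forall>y\<in>{0..1}. W (x, y) \<in> {0..1} \<and> W (x, y) + W (y, x) = 1)"

text \<open>
  The cube is the set of extensional functions from \<open>{..<l}\<close> to \<open>{0..1}\<close>. The completion of the
  product measure is Lebesgue measure on it; without completing, the integrand need not be
  measurable when \<open>W\<close> is only Lebesgue measurable.
\<close>

definition cube_lebesgue :: "nat \<Rightarrow> (nat \<Rightarrow> real) measure" where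
  "cube_lebesgue l = completion (Pi\<^sub>M {..<l} (\<lambda>_. restrict_space lborel {0..1}))"

definition cycle_density :: "nat \<Rightarrow> (real \<times> real \<Rightarrow> real) \<Rightarrow> real" where
  "cycle_density l W = (\<integral>x. (\<Prod>i<l. W (x i, x (Suc i mod l))) \<partial>cube_lebesgue l)"

definition z_power_sum :: "nat \<Rightarrow> real \<Rightarrow> real" where
  "z_power_sum k z = of_int \<lfloor>inverse z\<rfloor> * z ^ k + (1 - of_int \<lfloor>inverse z\<rfloor> * z) ^ k"

text \<open>
  The implicit definition of \<open>g\<close>: its value at \<open>1/8 * z_power_sum 3 z\<close> is
  \<open>1/16 * z_power_sum 4 z\<close> (see \<open>g_eq\<close> below). Only arguments in \<open>{0..1/8}\<close> are meaningful.
\<close>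

definition g :: "real \<Rightarrow> real" where
  "g t = (if t = 0 then 0
          else 1/16 * z_power_sum 4 (the_inv_into {0<..1} (\<lambda>z. 1/8 * z_power_sum 3 z) t))"

lemma floor_inverse_eq_iff:
  fixes z :: real
  assumes "z > 0" "n \<ge> 1"
  shows "\<lfloor>inverse z\<rfloor> = int n \<longleftrightarrow> 1 / (real n + 1) < z \<and> z \<le> 1 / real n"
  using assms by (auto simp: floor_eq_iff field_simps)

lemma cubic_strict_mono:
  fixes x y :: real
  assumes n: "n \<ge> 1" and x: "1 / (real n + 1) \<le> x" and xy: "x < y" and y: "y \<le> 1 / real n"
  shows "real n * x ^ 3 + (1 - real n * x) ^ 3 < real n * y ^ 3 + (1 - real n * y) ^ 3"
proof (rule DERIV_pos_imp_increasing_open[OF xy])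
  fix z assume z: "x < z" "z < y"
  have "1 / (real n + 1) < z" "z < 1 / real n" using z x y by auto
  then have "1 - real n * z < z" "0 < 1 - real n * z" using n by (auto simp: field_simps)
  then have "(1 - real n * z)\<^sup>2 < z\<^sup>2" by (intro power_strict_mono) auto
  then have pos: "3 * real n * (z\<^sup>2 - (1 - real n * z)\<^sup>2) > 0" using n by simp
  have "((\<lambda>z. real n * z ^ 3 + (1 - real n * z) ^ 3) has_real_derivative
          3 * real n * (z\<^sup>2 - (1 - real n * z)\<^sup>2)) (at z)"
    by (auto intro!: derivative_eq_intros simp: algebra_simps)
  with pos show "\<exists>d. ((\<lambda>z. real n * z ^ 3 + (1 - real n * z) ^ 3) has_real_derivative d) (at z) \<and> d > 0"
    by blast
qed (intro continuous_intros)

lemma cubic_ends: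
  assumes "n \<ge> 1"
  shows "real n * (1 / real n) ^ 3 + (1 - real n * (1 / real n)) ^ 3 = 1 / (real n)\<^sup>2"
    and "real n * (1 / (real n + 1)) ^ 3 + (1 - real n * (1 / (real n + 1))) ^ 3 = 1 / (real n + 1)\<^sup>2"
proof -
  show "real n * (1 / real n) ^ 3 + (1 - real n * (1 / real n)) ^ 3 = 1 / (real n)\<^sup>2"
    using assms by (simp add: power2_eq_square power3_eq_cube)
  have "1 - real n * (1 / (real n + 1)) = 1 / (real n + 1)" by (simp add: field_simps)
  then have "real n * (1 / (real n + 1)) ^ 3 + (1 - real n * (1 / (real n + 1))) ^ 3
      = (real n + 1) * (1 / (real n + 1)) ^ 3"
    by (simp add: distrib_right)
  also have "\<dots> = 1 / (real n + 1)\<^sup>2"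
    by (simp add: power2_eq_square power3_eq_cube)
  finally show "real n * (1 / (real n + 1)) ^ 3 + (1 - real n * (1 / (real n + 1))) ^ 3 = 1 / (real n + 1)\<^sup>2" .
qed

lemma z_cases:
  fixes z :: real
  assumes "z \<in> {0<..1}"
  obtains n where "n \<ge> 1" "1 / (real n + 1) < z" "z \<le> 1 / real n"
    "\<And>k. z_power_sum k z = real n * z ^ k + (1 - real n * z) ^ k"
proof -
  define n where "n = nat \<lfloor>inverse z\<rfloor>"
  have "inverse z \<ge> 1" using assms by (simp add: one_le_inverse)
  then have 1: "\<lfloor>inverse z\<rfloor> \<ge> 1" by linarith
  then have 2: "\<lfloor>inverse z\<rfloor> = int n" "n \<ge> 1" unfolding n_def by linarith+
  show ?thesis using that[OF 2(2)] floor_inverse_eq_iff[of z n] 2 assms by (simp add: z_power_sum_def)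
qed

lemma z_power_sum_3_bounds:
  fixes z :: real
  assumes "n \<ge> 1" "1 / (real n + 1) < z" "z \<le> 1 / real n"
    "z_power_sum 3 z = real n * z ^ 3 + (1 - real n * z) ^ 3"
  shows "1 / (real n + 1)\<^sup>2 < z_power_sum 3 z" "z_power_sum 3 z \<le> 1 / (real n)\<^sup>2"
proof -
  show "1 / (real n + 1)\<^sup>2 < z_power_sum 3 z"
    using cubic_strict_mono[of n "1 / (real n + 1)" z] cubic_ends[of n] assms by simp
  show "z_power_sum 3 z \<le> 1 / (real n)\<^sup>2"
    using cubic_strict_mono[of n z "1 / real n"] cubic_ends(1)[of n] assms
    by (cases "z = 1 / real n") (auto simp: less_eq_real_def)
qed

lemma z_power_sum_3_strict_mono: "strict_mono_on {0<..1} (z_power_sum 3)"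
proof (rule strict_mono_onI)
  fix x y :: real assume x: "x \<in> {0<..1}" and y: "y \<in> {0<..1}" and xy: "x < y"
  obtain m where m: "m \<ge> 1" "1 / (real m + 1) < x" "x \<le> 1 / real m"
    "\<And>k. z_power_sum k x = real m * x ^ k + (1 - real m * x) ^ k"
    using z_cases[OF x] by blast
  obtain n where n: "n \<ge> 1" "1 / (real n + 1) < y" "y \<le> 1 / real n"
    "\<And>k. z_power_sum k y = real n * y ^ k + (1 - real n * y) ^ k"
    using z_cases[OF y] by blast
  have "1 / (real m + 1) < 1 / real n" using m n xy by linarith
  then have "n \<le> m" using n(1) by (simp add: field_simps)
  show "z_power_sum 3 x < z_power_sum 3 y"
  proof (cases "n = m")
    case True
    then show ?thesis using cubic_strict_mono[of n x y] m n xy by simp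
  next
    case False
    then have "real n + 1 \<le> real m" using \<open>n \<le> m\<close> by linarith
    then have "1 / (real m)\<^sup>2 \<le> 1 / (real n + 1)\<^sup>2"
      by (intro divide_left_mono power_mono mult_pos_pos) (use m in auto)
    then show ?thesis
      using z_power_sum_3_bounds[OF m(1-3)] z_power_sum_3_bounds[OF n(1-3)] m(4) n(4)
      by (smt (verit))
  qed
qed

lemma z_power_sum_3_bij: "bij_betw (\<lambda>z. 1/8 * z_power_sum 3 z) {0<..1} {0<..1/8}"
  unfolding bij_betw_def
proof
  show "inj_on (\<lambda>z. 1/8 * z_power_sum 3 z) {0<..1}"
    using strict_mono_on_imp_inj_on[OF z_power_sum_3_strict_mono] by (auto simp: inj_on_def)
  show "(\<lambda>z. 1/8 * z_power_sum 3 z) ` {0<..1} = {0<..1/8}"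
  proof (intro equalityI subsetI)
    fix t assume "t \<in> (\<lambda>z. 1/8 * z_power_sum 3 z) ` {0<..1}"
    then obtain z where z: "z \<in> {0<..1}" "t = 1/8 * z_power_sum 3 z" by auto
    obtain n where n: "n \<ge> 1" "1 / (real n + 1) < z" "z \<le> 1 / real n"
      "\<And>k. z_power_sum k z = real n * z ^ k + (1 - real n * z) ^ k"
      using z_cases[OF z(1)] by blast
    have "1 / (real n)\<^sup>2 \<le> 1" "0 < 1 / (real n + 1)\<^sup>2" using n(1) by auto
    then have "0 < z_power_sum 3 z" "z_power_sum 3 z \<le> 1"
      using z_power_sum_3_bounds[OF n] by linarith+
    then show "t \<in> {0<..1/8}" using z(2) by simp
  next
    fix t :: real assume t: "t \<in> {0<..1/8}"
    define n where "n = nat \<lfloor>1 / sqrt (8 * t)\<rfloor>"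
    have s: "0 < sqrt (8 * t)" "sqrt (8 * t) \<le> 1" using t by auto
    have "1 / sqrt (8 * t) \<ge> 1" using s by simp
    then have n: "n \<ge> 1" "real n \<le> 1 / sqrt (8 * t)" "1 / sqrt (8 * t) < real n + 1"
      unfolding n_def by linarith+
    have st: "(sqrt (8 * t))\<^sup>2 = 8 * t" using t by simp
    have "sqrt (8 * t) \<le> 1 / real n" "1 / (real n + 1) < sqrt (8 * t)"
      using n s by (simp_all add: field_simps)
    then have "(sqrt (8 * t))\<^sup>2 \<le> (1 / real n)\<^sup>2" "(1 / (real n + 1))\<^sup>2 < (sqrt (8 * t))\<^sup>2"
      using s by (intro power_mono power_strict_mono; simp)+
    then have b: "8 * t \<le> 1 / (real n)\<^sup>2" "1 / (real n + 1)\<^sup>2 < 8 * t"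
      unfolding st by (simp_all add: power_divide)
    let ?p = "\<lambda>z. real n * z ^ 3 + (1 - real n * z) ^ 3"
    have "\<exists>z\<ge>1 / (real n + 1). z \<le> 1 / real n \<and> ?p z = 8 * t"
      by (rule IVT') (use b cubic_ends[OF n(1)] n(1) in \<open>auto intro!: continuous_intros divide_left_mono simp: less_imp_le\<close>)
    then obtain z where z: "1 / (real n + 1) \<le> z" "z \<le> 1 / real n" "?p z = 8 * t" by blast
    have "z \<noteq> 1 / (real n + 1)" using z(3) b(2) cubic_ends(2)[OF n(1)] by auto
    then have z1: "1 / (real n + 1) < z" using z(1) by simp
    have z0: "0 < z" using z1 by (rule less_trans[rotated]) simp
    moreover have "1 / real n \<le> 1" using n(1) by simp
    ultimately have "z \<in> {0<..1}" using z(2) by auto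
    moreover have "z_power_sum 3 z = 8 * t"
      using floor_inverse_eq_iff[OF z0 n(1)] z1 z(2,3) by (simp add: z_power_sum_def)
    ultimately show "t \<in> (\<lambda>z. 1/8 * z_power_sum 3 z) ` {0<..1}" by (intro image_eqI[of _ _ z]) auto
  qed
qed

lemma g_eq:
  assumes "z \<in> {0<..1}"
  shows "g (1/8 * z_power_sum 3 z) = 1/16 * z_power_sum 4 z"
proof -
  have "1/8 * z_power_sum 3 z \<in> {0<..1/8}" using bij_betwE[OF z_power_sum_3_bij] assms by blast
  then have "1/8 * z_power_sum 3 z \<noteq> 0" by auto
  moreover have "the_inv_into {0<..1} (\<lambda>z. 1/8 * z_power_sum 3 z) (1/8 * z_power_sum 3 z) = z"
    using the_inv_into_f_f[OF bij_betw_imp_inj_on[OF z_power_sum_3_bij] assms] .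
  ultimately show ?thesis by (simp add: g_def)
qed

end

theory Submission
  imports Defs "HOL-Probability.Infinite_Product_Measure"
begin

text \<open>
  Write \<open>W = 1/2 + A\<close> with \<open>A\<close> antisymmetric, let \<open>a x = \<integral>y. A x y\<close> be the row means and decompose
  \<open>A x y = a x - a y + C x y\<close>, so that \<open>C\<close> is antisymmetric with vanishing row means. Expanding the
  traces of \<open>(1/2 + A)\<^sup>3\<close> and \<open>(1/2 + A)\<^sup>4\<close>, with \<open>s = \<integral>x. (a x)\<^sup>2\<close>, \<open>D = C C\<^sup>T\<close> and \<open>e = C a\<close>, the
  three-cycle density is \<open>1/8 - 3/2 * s\<close> and the four-cycle density is
  \<open>1/16 - s + \<parallel>A A\<^sup>T\<parallel>\<^sup>2 = 1/16 - s + 2 * s\<^sup>2 + \<parallel>D\<parallel>\<^sup>2 + 4 * \<parallel>e\<parallel>\<^sup>2\<close>. In the range \<open>t \<ge> 1/32\<close>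
  the function \<open>g\<close> is given by its branch \<open>\<lfloor>1/z\<rfloor> = 1\<close> (which extends to \<open>z = 1/2\<close>), where \<open>g (1/8 - 3/2 * s) = 1/16 - s + 2 * s\<^sup>2\<close>.
  Equality therefore means \<open>D = 0\<close> and \<open>e = 0\<close>, which holds iff \<open>C = 0\<close> almost everywhere, and then
  \<open>f\<close> is \<open>a\<close> shifted by its essential infimum.
\<close>

subsection \<open>Bounded kernels on a probability space\<close>

text \<open>The bound holds at every point of the space, not just almost everywhere. The class is
  therefore closed under composition with measurable maps, in particular under taking sections, and
  its members are integrable for finite measures.\<close>

definition bounded_measurable :: "'a measure \<Rightarrow> ('a \<Rightarrow> real) \<Rightarrow> bool" where
  "bounded_measurable M f \<longleftrightarrow> f \<in> borel_measurable M \<and> (\<exists>c. \<forall>x\<in>space M. \<bar>f x\<bar> \<le> c)"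

lemma bounded_measurableI:
  "f \<in> borel_measurable M \<Longrightarrow> (\<And>x. x \<in> space M \<Longrightarrow> \<bar>f x\<bar> \<le> c) \<Longrightarrow> bounded_measurable M f"
  unfolding bounded_measurable_def by blast

lemma bounded_measurable_borel: "bounded_measurable M f \<Longrightarrow> f \<in> borel_measurable M"
  unfolding bounded_measurable_def by blast

lemma bounded_measurable_const [simp]: "bounded_measurable M (\<lambda>x. c)"
  by (rule bounded_measurableI[of _ _ "\<bar>c\<bar>"]) auto

lemma bounded_measurable_add [simp]:
  assumes "bounded_measurable M f" "bounded_measurable M h"
  shows "bounded_measurable M (\<lambda>x. f x + h x)"
proof -
  obtain c d where "\<forall>x\<in>space M. \<bar>f x\<bar> \<le> c" "\<forall>x\<in>space M. \<bar>h x\<bar> \<le> d"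
    using assms unfolding bounded_measurable_def by blast
  then have "\<bar>f x + h x\<bar> \<le> c + d" if "x \<in> space M" for x
    using that abs_triangle_ineq[of "f x" "h x"] by fastforce
  with assms show ?thesis
    by (auto simp: bounded_measurable_def)
qed

lemma bounded_measurable_mult [simp]:
  assumes "bounded_measurable M f" "bounded_measurable M h"
  shows "bounded_measurable M (\<lambda>x. f x * h x)"
proof -
  obtain c d where cd: "\<forall>x\<in>space M. \<bar>f x\<bar> \<le> c" "\<forall>x\<in>space M. \<bar>h x\<bar> \<le> d"
    using assms unfolding bounded_measurable_def by blast
  have "\<bar>f x * h x\<bar> \<le> c * d" if "x \<in> space M" for x
    unfolding abs_mult using that cd by (intro mult_mono) fastforce+
  with assms show ?thesis
    by (auto simp: bounded_measurable_def)
qed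

lemma bounded_measurable_uminus [simp]:
  "bounded_measurable M f \<Longrightarrow> bounded_measurable M (\<lambda>x. - f x)"
  using bounded_measurable_mult[of M "\<lambda>_. - 1" f] by simp

lemma bounded_measurable_diff [simp]:
  "bounded_measurable M f \<Longrightarrow> bounded_measurable M h \<Longrightarrow> bounded_measurable M (\<lambda>x. f x - h x)"
  using bounded_measurable_add[of M f "\<lambda>x. - h x"] by simp

lemma bounded_measurable_power [simp]:
  "bounded_measurable M f \<Longrightarrow> bounded_measurable M (\<lambda>x. f x ^ n)"
  by (induction n) auto

lemma bounded_measurable_compose:
  "bounded_measurable N f \<Longrightarrow> h \<in> measurable M N \<Longrightarrow> bounded_measurable M (\<lambda>x. f (h x))"
  unfolding bounded_measurable_def by (auto dest: measurable_space)

lemma (in finite_measure) bounded_measurable_integrable [simp]: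
  "bounded_measurable M f \<Longrightarrow> integrable M f"
  unfolding bounded_measurable_def by (force intro!: integrable_const_bound AE_I2)

lemma (in prob_space) bounded_measurable_integral:
  assumes "bounded_measurable (N \<Otimes>\<^sub>M M) (\<lambda>(x, y). F x y)"
  shows "bounded_measurable N (\<lambda>x. \<integral>y. F x y \<partial>M)"
proof -
  obtain c where c: "\<And>x y. x \<in> space N \<Longrightarrow> y \<in> space M \<Longrightarrow> \<bar>F x y\<bar> \<le> c"
    using assms unfolding bounded_measurable_def by (auto simp: space_pair_measure)
  have [measurable]: "(\<lambda>(x, y). F x y) \<in> borel_measurable (N \<Otimes>\<^sub>M M)"
    using assms by (rule bounded_measurable_borel)
  have "\<bar>\<integral>y. F x y \<partial>M\<bar> \<le> c" if x: "x \<in> space N" for x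
  proof -
    have [measurable]: "F x \<in> borel_measurable M"
      using x measurable_Pair2[of "\<lambda>(x, y). F x y"] by simp
    have "integrable M (F x)"
      using c[OF x] by (intro bounded_measurable_integrable bounded_measurableI) auto
    then have "norm (\<integral>y. F x y \<partial>M) \<le> (\<integral>y. c \<partial>M)"
      using c[OF x] by (intro order_trans[OF integral_norm_bound] integral_mono) auto
    then show ?thesis by (simp add: prob_space)
  qed
  then show ?thesis by (intro bounded_measurableI[where c = c]) measurable
qed

text \<open>Written with projections, so that the closure rules for sums, products and powers apply
  to a kernel as to any other function on a measurable space.\<close>

abbreviation bounded_kernel :: "'a measure \<Rightarrow> ('a \<Rightarrow> 'a \<Rightarrow> real) \<Rightarrow> bool" where
  "bounded_kernel M K \<equiv> bounded_measurable (M \<Otimes>\<^sub>M M) (\<lambda>p. K (fst p) (snd p))"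

lemma bounded_kernel_compose:
  assumes "bounded_kernel M K" "f \<in> measurable N M" "h \<in> measurable N M"
  shows "bounded_measurable N (\<lambda>x. K (f x) (h x))"
  using bounded_measurable_compose[OF assms(1), of "\<lambda>x. (f x, h x)" N] assms(2,3) by simp

context prob_space
begin

lemma bounded_kernel_row [simp]:
  "bounded_kernel M K \<Longrightarrow> bounded_measurable M (\<lambda>x. \<integral>y. K x y \<partial>M)"
  by (rule bounded_measurable_integral) (simp add: case_prod_beta')

lemma bounded_kernel_mult [simp]:
  assumes "bounded_kernel M K" "bounded_kernel M L"
  shows "bounded_kernel M (\<lambda>x y. \<integral>z. K x z * L y z \<partial>M)"
  by (rule bounded_measurable_integral)
    (simp add: case_prod_beta' assms[THEN bounded_kernel_compose])

lemma integral_swap: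
  assumes "bounded_kernel M K"
  shows "(\<integral>x. \<integral>y. K x y \<partial>M \<partial>M) = (\<integral>y. \<integral>x. K x y \<partial>M \<partial>M)"
proof -
  interpret P: pair_prob_space M M ..
  show ?thesis
    using assms by (intro P.Fubini_integral[symmetric]) (simp add: case_prod_beta')
qed

lemma integral_pair:
  assumes "bounded_kernel M K"
  shows "(\<integral>p. K (fst p) (snd p) \<partial>(M \<Otimes>\<^sub>M M)) = (\<integral>x. \<integral>y. K x y \<partial>M \<partial>M)"
proof -
  interpret P: pair_prob_space M M ..
  show ?thesis
    using P.integral_fst[of K] assms by (simp add: case_prod_beta')
qed

declare prob_space [simp]

text \<open>Two applications of Fubini bring the shared variable \<open>z\<close> outermost, where
  the integrand factors. In operator terms, \<open>K\<close> moves across the inner product. With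
  \<open>f = h = a\<close> this produces the norm of \<open>e\<close>; with indicators it turns
  \<open>D = 0\<close> into the vanishing of averages of \<open>C\<close>.\<close>

lemma integral_gram:
  assumes K: "bounded_kernel M K" and f: "bounded_measurable M f" and h: "bounded_measurable M h"
  shows "(\<integral>x. \<integral>y. f x * h y * (\<integral>z. K x z * K y z \<partial>M) \<partial>M \<partial>M)
    = (\<integral>z. (\<integral>x. f x * K x z \<partial>M) * (\<integral>y. h y * K y z \<partial>M) \<partial>M)"
proof -
  note [simp] = bounded_kernel_compose[OF K] bounded_measurable_compose[OF f]
    bounded_measurable_compose[OF h]
  have "bounded_measurable M (\<lambda>z. \<integral>y. h y * K y z \<partial>M)"
    by (rule bounded_kernel_row) simp
  note [simp] = bounded_measurable_compose[OF this]
  have "(\<integral>y. f x * h y * (\<integral>z. K x z * K y z \<partial>M) \<partial>M)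
      = (\<integral>z. f x * K x z * (\<integral>y. h y * K y z \<partial>M) \<partial>M)" (is "?l = ?r") if x: "x \<in> space M" for x
  proof -
    have "?l = (\<integral>y. \<integral>z. f x * h y * (K x z * K y z) \<partial>M \<partial>M)" by simp
    also have "\<dots> = (\<integral>z. \<integral>y. f x * h y * (K x z * K y z) \<partial>M \<partial>M)"
      by (rule integral_swap) (use x in simp)
    also have "\<dots> = (\<integral>z. \<integral>y. f x * K x z * (h y * K y z) \<partial>M \<partial>M)" by (simp add: ac_simps)
    also have "\<dots> = ?r" by simp
    finally show ?thesis .
  qed
  then have "(\<integral>x. \<integral>y. f x * h y * (\<integral>z. K x z * K y z \<partial>M) \<partial>M \<partial>M)
      = (\<integral>x. \<integral>z. f x * K x z * (\<integral>y. h y * K y z \<partial>M) \<partial>M \<partial>M)"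
    by (rule Bochner_Integration.integral_cong[OF refl])
  also have "\<dots> = (\<integral>z. \<integral>x. f x * K x z * (\<integral>y. h y * K y z \<partial>M) \<partial>M \<partial>M)"
    by (rule integral_swap) simp
  also have "\<dots> = (\<integral>z. (\<integral>x. f x * K x z \<partial>M) * (\<integral>y. h y * K y z \<partial>M) \<partial>M)" by simp
  finally show ?thesis .
qed

end

subsection \<open>Antisymmetric kernels\<close>

locale antisymmetric_kernel = prob_space +
  fixes A :: "'a \<Rightarrow> 'a \<Rightarrow> real"
  assumes bounded_A: "bounded_kernel M A"
    and antisym: "A x y = - A y x"
begin

definition a where "a x = (\<integral>y. A x y \<partial>M)"
definition C where "C x y = A x y - (a x - a y)"
definition D where "D x y = (\<integral>z. C x z * C y z \<partial>M)"
definition e where "e x = (\<integral>y. C x y * a y \<partial>M)"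
definition s where "s = (\<integral>x. (a x)\<^sup>2 \<partial>M)"

lemmas bounded_A' [simp] = bounded_kernel_compose[OF bounded_A]

lemma bounded_a: "bounded_measurable M a"
  unfolding a_def by simp

lemmas bounded_a' [simp] = bounded_a bounded_measurable_compose[OF bounded_a]

lemma bounded_C: "bounded_kernel M C"
  unfolding C_def by simp

lemmas bounded_C' [simp] = bounded_kernel_compose[OF bounded_C]

lemma bounded_D: "bounded_kernel M D"
  unfolding D_def by (simp add: bounded_C)

lemmas bounded_D' [simp] = bounded_kernel_compose[OF bounded_D]

lemma bounded_e: "bounded_measurable M e"
  unfolding e_def by simp

lemmas bounded_e' [simp] = bounded_e bounded_measurable_compose[OF bounded_e]

lemma antisym_C: "C x y = - C y x"
  using antisym[of x y] by (simp add: C_def)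

lemma D_commute: "D x y = D y x"
  by (simp add: D_def mult.commute)

text \<open>Exchanging the two variables sends the integral to its negative.\<close>

lemma integral_antisymmetric:
  assumes "bounded_kernel M K" "\<And>x y. K x y = - K y x"
  shows "(\<integral>x. \<integral>y. K x y \<partial>M \<partial>M) = 0"
proof -
  have "(\<integral>x. \<integral>y. K x y \<partial>M \<partial>M) = (\<integral>y. \<integral>x. K x y \<partial>M \<partial>M)"
    by (rule integral_swap[OF assms(1)])
  also have "\<dots> = (\<integral>y. \<integral>x. - K y x \<partial>M \<partial>M)"
    by (subst assms(2)) (rule refl)
  finally show ?thesis by simp
qed

lemma integral_a [simp]: "(\<integral>x. a x \<partial>M) = 0"
  unfolding a_def using bounded_A antisym by (rule integral_antisymmetric)

lemma integral_C [simp]: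
  assumes [simp]: "x \<in> space M"
  shows "(\<integral>y. C x y \<partial>M) = 0" "(\<integral>y. C y x \<partial>M) = 0"
proof -
  show "(\<integral>y. C x y \<partial>M) = 0"
    unfolding C_def by (simp add: a_def[symmetric])
  then have "(\<integral>y. - C x y \<partial>M) = 0" by simp
  then show "(\<integral>y. C y x \<partial>M) = 0"
    by (simp only: antisym_C[symmetric])
qed

lemma integral_D [simp]:
  assumes [simp]: "x \<in> space M"
  shows "(\<integral>y. D x y \<partial>M) = 0" "(\<integral>y. D y x \<partial>M) = 0"
proof -
  have "(\<integral>y. D x y \<partial>M) = (\<integral>z. \<integral>y. C x z * C y z \<partial>M \<partial>M)"
    unfolding D_def by (rule integral_swap) simp
  also have "\<dots> = (\<integral>z. 0 \<partial>M)"
    by (rule Bochner_Integration.integral_cong) auto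
  finally show "(\<integral>y. D x y \<partial>M) = 0" by simp
  then show "(\<integral>y. D y x \<partial>M) = 0"
    by (simp add: D_commute[of _ x])
qed

lemma integral_e [simp]: "(\<integral>x. e x \<partial>M) = 0"
proof -
  have "(\<integral>x. e x \<partial>M) = (\<integral>y. \<integral>x. C x y * a y \<partial>M \<partial>M)"
    unfolding e_def by (rule integral_swap) simp
  also have "\<dots> = (\<integral>z. 0 \<partial>M)"
    by (rule Bochner_Integration.integral_cong) auto
  finally show ?thesis by simp
qed

text \<open>Multiplying \<open>A x z = C x z + a x - a z\<close> by its analogue for
  \<open>y\<close> gives nine terms. Four of them are a constant times \<open>C x z\<close>,
  \<open>C y z\<close> or \<open>a z\<close>, and these integrate to zero over
  \<open>z\<close>.\<close>

lemma gram_A: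
  assumes [simp]: "x \<in> space M" "y \<in> space M"
  shows "(\<integral>z. A x z * A y z \<partial>M) = D x y + a x * a y - e x - e y + s"
proof -
  have "(\<integral>z. A x z * A y z \<partial>M) = (\<integral>z. C x z * C y z + a y * C x z - C x z * a z + a x * C y z
      + a x * a y - a x * a z - C y z * a z - a y * a z + (a z)\<^sup>2 \<partial>M)"
    by (rule Bochner_Integration.integral_cong)
      (simp_all add: C_def algebra_simps power2_eq_square)
  also have "\<dots> = D x y + a x * a y - e x - e y + s"
    by (simp add: D_def e_def s_def)
  finally show ?thesis .
qed

text \<open>By \<open>gram_A\<close> this is the squared norm of a sum of five kernels. Since
  \<open>a\<close>, \<open>e\<close>, and the rows and columns of \<open>D\<close> have mean zero,
  the only surviving cross term is that of \<open>D x y\<close> with \<open>a x * a y\<close>. It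
  gives twice the squared norm of \<open>e\<close>; the kernels \<open>e x\<close> and
  \<open>e y\<close> add one each. The kernels \<open>a x * a y\<close> and \<open>s\<close> give
  the two squares of \<open>s\<close>.\<close>

lemma integral_square:
  "(\<integral>x. \<integral>y. (\<integral>z. A x z * A y z \<partial>M)\<^sup>2 \<partial>M \<partial>M)
    = 2 * s\<^sup>2 + (\<integral>x. \<integral>y. (D x y)\<^sup>2 \<partial>M \<partial>M) + 4 * (\<integral>x. (e x)\<^sup>2 \<partial>M)"
proof -
  \<comment> \<open>These row integrals become integrands in \<open>x\<close>, so they must be known
    to be bounded before the outer integral is split.\<close>
  have Dxy: "bounded_measurable M (\<lambda>x. \<integral>y. D x y * a y \<partial>M)"
    "bounded_measurable M (\<lambda>x. \<integral>y. D x y * e y \<partial>M)"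
    "bounded_measurable M (\<lambda>x. \<integral>y. (D x y)\<^sup>2 \<partial>M)"
    by (simp_all)
  note [simp] = Dxy
  have "(\<integral>y. (\<integral>z. A x z * A y z \<partial>M)\<^sup>2 \<partial>M)
      = (\<integral>y. (D x y)\<^sup>2 \<partial>M) + (a x)\<^sup>2 * s + (e x)\<^sup>2 + (\<integral>y. (e y)\<^sup>2 \<partial>M) + s\<^sup>2
        + 2 * (a x * (\<integral>y. D x y * a y \<partial>M)) - 2 * (\<integral>y. D x y * e y \<partial>M)
        - 2 * (\<integral>y. a y * e y \<partial>M) * a x - 2 * s * e x" (is "?l = ?r")
    if [simp]: "x \<in> space M" for x
  proof -
    have "?l = (\<integral>y. (D x y + a x * a y - e x - e y + s)\<^sup>2 \<partial>M)"
      by (rule Bochner_Integration.integral_cong) (simp_all add: gram_A)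
    also have "\<dots> = (\<integral>y. (D x y)\<^sup>2 + (a x)\<^sup>2 * (a y)\<^sup>2 + (e x)\<^sup>2 + (e y)\<^sup>2 + s\<^sup>2
        + 2 * a x * (D x y * a y) - 2 * e x * D x y - 2 * (D x y * e y) + 2 * s * D x y
        - 2 * a x * e x * a y - 2 * a x * (a y * e y) + 2 * s * a x * a y
        + 2 * e x * e y - 2 * s * e x - 2 * s * e y \<partial>M)"
      by (rule Bochner_Integration.integral_cong) (simp_all add: algebra_simps power2_eq_square)
    also have "\<dots> = ?r"
      by (simp add: s_def[symmetric])
    finally show ?thesis .
  qed
  then have "(\<integral>x. \<integral>y. (\<integral>z. A x z * A y z \<partial>M)\<^sup>2 \<partial>M \<partial>M)
      = (\<integral>x. (\<integral>y. (D x y)\<^sup>2 \<partial>M) + (a x)\<^sup>2 * s + (e x)\<^sup>2 + (\<integral>y. (e y)\<^sup>2 \<partial>M) + s\<^sup>2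
        + 2 * (a x * (\<integral>y. D x y * a y \<partial>M)) - 2 * (\<integral>y. D x y * e y \<partial>M)
        - 2 * (\<integral>y. a y * e y \<partial>M) * a x - 2 * s * e x \<partial>M)"
    by (rule Bochner_Integration.integral_cong[OF refl])
  also have "\<dots> = (\<integral>x. \<integral>y. (D x y)\<^sup>2 \<partial>M \<partial>M) + s * s + 2 * (\<integral>x. (e x)\<^sup>2 \<partial>M) + s\<^sup>2
      + 2 * (\<integral>x. a x * (\<integral>y. D x y * a y \<partial>M) \<partial>M) - 2 * (\<integral>x. \<integral>y. D x y * e y \<partial>M \<partial>M)"
    by (simp add: s_def[symmetric])
  also have "(\<integral>x. \<integral>y. D x y * e y \<partial>M \<partial>M) = 0"
  proof -
    have "(\<integral>x. \<integral>y. D x y * e y \<partial>M \<partial>M) = (\<integral>y. \<integral>x. D x y * e y \<partial>M \<partial>M)"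
      by (rule integral_swap) simp
    also have "\<dots> = (\<integral>z. 0 \<partial>M)"
      by (rule Bochner_Integration.integral_cong) auto
    finally show ?thesis by simp
  qed
  also have "(\<integral>x. a x * (\<integral>y. D x y * a y \<partial>M) \<partial>M) = (\<integral>x. (e x)\<^sup>2 \<partial>M)"
  proof -
    have "(\<integral>x. a x * (\<integral>y. D x y * a y \<partial>M) \<partial>M) = (\<integral>x. \<integral>y. a x * a y * (\<integral>z. C x z * C y z \<partial>M) \<partial>M \<partial>M)"
      by (simp add: D_def[symmetric] ac_simps del: integral_mult_right_zero flip: integral_mult_right_zero)
    also have "\<dots> = (\<integral>z. (\<integral>x. a x * C x z \<partial>M) * (\<integral>x. a x * C x z \<partial>M) \<partial>M)"
      by (rule integral_gram) (simp_all add: bounded_C)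
    \<comment> \<open>The transpose of \<open>C\<close> is \<open>- C\<close>; the resulting sign
      disappears in the product.\<close>
    also have "(\<lambda>z. \<integral>x. a x * C x z \<partial>M) = (\<lambda>z. - e z)"
      by (subst antisym_C) (simp add: e_def mult.commute)
    finally show ?thesis by (simp add: power2_eq_square)
  qed
  finally show ?thesis by (simp add: power2_eq_square)
qed

end

section \<open>Kernels with vanishing integral over every measurable rectangle\<close>

context prob_space
begin

text \<open>The function \<open>h = 1 + K / c\<close> is a nonnegative density whose measure agrees
  with the product measure on rectangles. Uniqueness of the product measure identifies the two
  measures, and uniqueness of densities then gives \<open>h = 1\<close> almost everywhere.\<close>

lemma AE_kernel_zero:
  assumes K: "bounded_kernel M K"
    and zero: "\<And>E F. E \<in> sets M \<Longrightarrow> F \<in> sets M \<Longrightarrow>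
      (\<integral>x. \<integral>y. indicator E x * indicator F y * K x y \<partial>M \<partial>M) = 0"
  shows "AE p in M \<Otimes>\<^sub>M M. K (fst p) (snd p) = 0"
proof -
  interpret P: pair_prob_space M M ..
  let ?P = "M \<Otimes>\<^sub>M M"
  note [simp] = bounded_kernel_compose[OF K]
  obtain c' where c': "\<And>p. p \<in> space ?P \<Longrightarrow> \<bar>K (fst p) (snd p)\<bar> \<le> c'"
    using K unfolding bounded_measurable_def by blast
  \<comment> \<open>The maximum with \<open>1\<close> keeps the divisor positive while
    \<open>c\<close> still bounds \<open>K\<close>, so that \<open>h\<close> is nonnegative.\<close>
  define c where "c = max c' 1"
  define h where "h p = 1 + K (fst p) (snd p) / c" for p
  have c: "c > 0" "\<And>p. p \<in> space ?P \<Longrightarrow> \<bar>K (fst p) (snd p)\<bar> \<le> c"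
    using c' by (fastforce simp: c_def)+
  have h: "bounded_measurable ?P h"
    unfolding h_def divide_inverse by simp
  have [measurable]: "h \<in> borel_measurable ?P"
    using h by (rule bounded_measurable_borel)
  have h0: "h p \<ge> 0" if "p \<in> space ?P" for p
    using c(2)[OF that] c(1) by (simp add: h_def field_simps)
  have "?P = density ?P (\<lambda>p. ennreal (h p))"
  proof (rule pair_measure_eqI)
    fix E F assume EF [measurable]: "E \<in> sets M" "F \<in> sets M"
    have ind [simp]: "bounded_measurable M (indicat_real E)" "bounded_measurable M (indicat_real F)"
      by (rule bounded_measurableI[of _ _ 1]; simp)+
    note [simp] = ind[THEN bounded_measurable_compose]
    have "emeasure (density ?P (\<lambda>p. ennreal (h p))) (E \<times> F)
        = (\<integral>\<^sup>+p. ennreal (h p) * indicator (E \<times> F) p \<partial>?P)"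
      by (rule emeasure_density) measurable
    also have "\<dots> = (\<integral>\<^sup>+p. ennreal (indicator E (fst p) * indicator F (snd p) * h p) \<partial>?P)"
      by (rule nn_integral_cong) (auto simp: indicator_def)
    also have "\<dots> = ennreal (\<integral>p. indicator E (fst p) * indicator F (snd p) * h p \<partial>?P)"
      by (rule nn_integral_eq_integral) (use h h0 in \<open>auto intro!: AE_I2 P.bounded_measurable_integrable\<close>)
    also have "(\<integral>p. indicator E (fst p) * indicator F (snd p) * h p \<partial>?P)
        = (\<integral>p. indicator E (fst p) * indicator F (snd p)
          + inverse c * (indicator E (fst p) * indicator F (snd p) * K (fst p) (snd p)) \<partial>?P)"
      by (simp add: h_def field_simps)
    also have "\<dots> = (\<integral>p. indicator E (fst p) * indicator F (snd p) \<partial>?P)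
        + inverse c * (\<integral>p. indicator E (fst p) * indicator F (snd p) * K (fst p) (snd p) \<partial>?P)"
      by simp
    also have "(\<integral>p. indicator E (fst p) * indicator F (snd p) * K (fst p) (snd p) \<partial>?P) = 0"
      by (subst integral_pair) (simp_all add: zero EF)
    also have "(\<integral>p. indicator E (fst p) * indicator F (snd p) \<partial>?P) = measure M E * measure M F"
      by (subst integral_pair) simp_all
    finally show "emeasure M E * emeasure M F = emeasure (density ?P (\<lambda>p. ennreal (h p))) (E \<times> F)"
      by (simp add: emeasure_eq_measure ennreal_mult)
  qed (auto intro: prob_space_imp_sigma_finite prob_space_axioms)
  then have "density ?P (\<lambda>p. ennreal (h p)) = density ?P (\<lambda>p. 1)"
    by (simp add: density_1)
  then have "AE p in ?P. ennreal (h p) = 1"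
    by (subst (asm) P.density_unique_iff) auto
  with AE_space show ?thesis
    by eventually_elim (use c(1) in \<open>simp add: h_def ennreal_eq_1\<close>)
qed

end

section \<open>Cycle integrals of \<open>1/2 + A\<close> and the vanishing of the defect\<close>

context antisymmetric_kernel
begin

text \<open>This is the kernel of the square of \<open>1/2 + A\<close>. Antisymmetry turns the
  product of \<open>A\<close> with itself into minus the Gram kernel, which \<open>gram_A\<close>
  evaluates.\<close>

lemma integral_walk2:
  assumes [simp]: "x \<in> space M" "y \<in> space M"
  shows "(\<integral>z. (1/2 + A x z) * (1/2 + A z y) \<partial>M)
    = 1/4 + (a x - a y) / 2 - (\<integral>z. A x z * A y z \<partial>M)"
proof -
  have "(\<integral>z. (1/2 + A x z) * (1/2 + A z y) \<partial>M)
      = (\<integral>z. 1/4 + 1/2 * A x z - 1/2 * A y z - A x z * A y z \<partial>M)"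
    by (simp add: antisym[of _ y] algebra_simps)
  also have "\<dots> = 1/4 + (a x - a y) / 2 - (\<integral>z. A x z * A y z \<partial>M)"
    by (simp add: a_def diff_divide_distrib)
  finally show ?thesis .
qed

text \<open>The product of \<open>A\<close> with the symmetric Gram kernel is antisymmetric and
  integrates to zero. Of the rest, the mean of the Gram kernel contributes \<open>- s / 2\<close>
  and the pairing of \<open>A x y\<close> with \<open>(a y - a x) / 2\<close> contributes
  \<open>- s\<close>.\<close>

lemma integral_cycle3:
  "(\<integral>x. \<integral>y. (1/2 + A x y) * (\<integral>z. (1/2 + A y z) * (1/2 + A z x) \<partial>M) \<partial>M \<partial>M) = 1/8 - 3/2 * s"
proof -
  let ?B = "\<lambda>x y. D x y + a x * a y - e x - e y + s"
  let ?K = "\<lambda>x y. A x y * ?B x y"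
  have [simp]: "bounded_measurable M (\<lambda>x. \<integral>y. ?K x y \<partial>M)"
    by simp
  have K: "(\<integral>x. \<integral>y. ?K x y \<partial>M \<partial>M) = 0"
    by (rule integral_antisymmetric) (simp, subst antisym, simp add: D_commute algebra_simps)
  have "(\<integral>y. (1/2 + A x y) * (\<integral>z. (1/2 + A y z) * (1/2 + A z x) \<partial>M) \<partial>M)
      = 1/8 + e x - s - 1/2 * (a x)\<^sup>2 - (\<integral>y. ?K x y \<partial>M)" (is "?l = ?r")
    if [simp]: "x \<in> space M" for x
  proof -
    have "?l = (\<integral>y. (1/8 + 1/4 * a y - 1/4 * a x) - (1/2 * D x y + 1/2 * a x * a y - 1/2 * e x - 1/2 * e y + 1/2 * s)
        + (1/4 * C x y + 1/4 * a x - 1/4 * a y)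
        + (1/2 * (C x y * a y) + 1/2 * a x * a y - 1/2 * (a y)\<^sup>2)
        - (1/2 * a x * C x y + 1/2 * (a x)\<^sup>2 - 1/2 * a x * a y) - ?K x y \<partial>M)"
      (is "integral\<^sup>L M ?f = integral\<^sup>L M ?h")
    proof (rule Bochner_Integration.integral_cong[OF refl])
      fix y assume y: "y \<in> space M"
      show "?f y = ?h y"
        by (simp only: integral_walk2[OF that y] integral_walk2[OF y that] gram_A[OF that y] gram_A[OF y that])
          (simp add: D_commute[of _ x] C_def algebra_simps power2_eq_square add_divide_distrib diff_divide_distrib)
    qed
    also have "\<dots> = ?r"
      by (simp add: s_def[symmetric] e_def[symmetric])
    finally show ?thesis .
  qed
  then have "(\<integral>x. \<integral>y. (1/2 + A x y) * (\<integral>z. (1/2 + A y z) * (1/2 + A z x) \<partial>M) \<partial>M \<partial>M)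
      = (\<integral>x. 1/8 + e x - s - 1/2 * (a x)\<^sup>2 - (\<integral>y. ?K x y \<partial>M) \<partial>M)"
    by (rule Bochner_Integration.integral_cong[OF refl])
  also have "\<dots> = 1/8 - s - 1/2 * s"
    by (subst Bochner_Integration.integral_diff) (simp_all add: K s_def[symmetric])
  finally show ?thesis by simp
qed

text \<open>With \<open>B\<close> the symmetric Gram kernel of \<open>A\<close>, the two walks are
  \<open>1/4 - B\<close> plus and minus \<open>(a x - a y) / 2\<close>, so their product is a
  difference of two squares. The mean of \<open>B\<close> and the square of
  \<open>(a x - a y) / 2\<close> each account for \<open>- s / 2\<close>; the square of
  \<open>B\<close> is \<open>integral_square\<close>.\<close>

lemma integral_cycle4:
  "(\<integral>x. \<integral>y. (\<integral>z. (1/2 + A x z) * (1/2 + A z y) \<partial>M) * (\<integral>z. (1/2 + A y z) * (1/2 + A z x) \<partial>M) \<partial>M \<partial>M)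
    = 1/16 - s + 2 * s\<^sup>2 + (\<integral>x. \<integral>y. (D x y)\<^sup>2 \<partial>M \<partial>M) + 4 * (\<integral>x. (e x)\<^sup>2 \<partial>M)"
proof -
  let ?B = "\<lambda>x y. \<integral>z. A x z * A y z \<partial>M"
  have B [simp]: "bounded_kernel M ?B" by (simp add: bounded_A)
  note [simp] = bounded_kernel_compose[OF B]
  have [simp]: "bounded_measurable M (\<lambda>x. \<integral>y. (?B x y)\<^sup>2 \<partial>M)"
    by simp
  have "(\<integral>y. (\<integral>z. (1/2 + A x z) * (1/2 + A z y) \<partial>M) * (\<integral>z. (1/2 + A y z) * (1/2 + A z x) \<partial>M) \<partial>M)
      = 1/16 + 1/2 * e x - 1/2 * s - 1/4 * (a x)\<^sup>2 - 1/4 * s + (\<integral>y. (?B x y)\<^sup>2 \<partial>M)" (is "?l = ?r")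
    if [simp]: "x \<in> space M" for x
  proof -
    have "?l = (\<integral>y. 1/16 - (1/2 * D x y + 1/2 * a x * a y - 1/2 * e x - 1/2 * e y + 1/2 * s)
        - (1/4 * (a x)\<^sup>2 - 1/2 * a x * a y + 1/4 * (a y)\<^sup>2) + (?B x y)\<^sup>2 \<partial>M)"
      (is "integral\<^sup>L M ?f = integral\<^sup>L M ?h")
    proof (rule Bochner_Integration.integral_cong[OF refl])
      fix y assume y: "y \<in> space M"
      show "?f y = ?h y"
        by (simp only: integral_walk2[OF that y] integral_walk2[OF y that] gram_A[OF that y] gram_A[OF y that])
          (simp add: D_commute[of _ x] algebra_simps power2_eq_square add_divide_distrib diff_divide_distrib)
    qed
    also have "\<dots> = ?r"
      by (simp add: s_def[symmetric])
    finally show ?thesis .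
  qed
  then have "(\<integral>x. \<integral>y. (\<integral>z. (1/2 + A x z) * (1/2 + A z y) \<partial>M) * (\<integral>z. (1/2 + A y z) * (1/2 + A z x) \<partial>M) \<partial>M \<partial>M)
      = (\<integral>x. 1/16 + 1/2 * e x - 1/2 * s - 1/4 * (a x)\<^sup>2 - 1/4 * s + (\<integral>y. (?B x y)\<^sup>2 \<partial>M) \<partial>M)"
    by (rule Bochner_Integration.integral_cong[OF refl])
  also have "\<dots> = 1/16 - s + (\<integral>x. \<integral>y. (?B x y)\<^sup>2 \<partial>M \<partial>M)"
    by (simp add: s_def[symmetric])
  finally show ?thesis by (simp add: integral_square)
qed

text \<open>If \<open>D = 0\<close>, then for every measurable \<open>E\<close> the quadratic form
  of \<open>D\<close> at the indicator of \<open>E\<close> is zero. By \<open>integral_gram\<close>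
  that form is the squared norm of the average of \<open>C\<close> over \<open>E\<close> in its
  first variable. Hence \<open>C\<close> integrates to zero over all rectangles.\<close>

lemma defect_eq_0_iff:
  "(\<integral>x. \<integral>y. (D x y)\<^sup>2 \<partial>M \<partial>M) + 4 * (\<integral>x. (e x)\<^sup>2 \<partial>M) = 0
    \<longleftrightarrow> (AE p in M \<Otimes>\<^sub>M M. C (fst p) (snd p) = 0)"
proof -
  interpret P: pair_prob_space M M ..
  show ?thesis
  proof
    assume C0: "AE p in M \<Otimes>\<^sub>M M. C (fst p) (snd p) = 0"
    have *: "AE x in M. AE y in M. C x y = 0"
      using P.AE_pair[OF C0] by simp
    then have "AE x in M. (e x)\<^sup>2 = 0"
    proof eventually_elim
      case (elim x)
      then have "e x = 0"
        unfolding e_def by (intro integral_eq_zero_AE) auto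
      then show ?case by simp
    qed
    then have "(\<integral>x. (e x)\<^sup>2 \<partial>M) = 0" by (rule integral_eq_zero_AE)
    moreover have "AE x in M. (\<integral>y. (D x y)\<^sup>2 \<partial>M) = 0"
      using *
    proof eventually_elim
      case (elim x)
      then have "D x y = 0" for y
        unfolding D_def by (intro integral_eq_zero_AE) auto
      then show ?case by simp
    qed
    then have "(\<integral>x. \<integral>y. (D x y)\<^sup>2 \<partial>M \<partial>M) = 0" by (rule integral_eq_zero_AE)
    ultimately show "(\<integral>x. \<integral>y. (D x y)\<^sup>2 \<partial>M \<partial>M) + 4 * (\<integral>x. (e x)\<^sup>2 \<partial>M) = 0" by simp
  next
    assume 0: "(\<integral>x. \<integral>y. (D x y)\<^sup>2 \<partial>M \<partial>M) + 4 * (\<integral>x. (e x)\<^sup>2 \<partial>M) = 0"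
    have "(\<integral>x. \<integral>y. (D x y)\<^sup>2 \<partial>M \<partial>M) \<ge> 0" "(\<integral>x. (e x)\<^sup>2 \<partial>M) \<ge> 0"
      by (auto intro!: integral_nonneg_AE)
    with 0 have "(\<integral>x. \<integral>y. (D x y)\<^sup>2 \<partial>M \<partial>M) = 0" by linarith
    then have "(\<integral>p. (D (fst p) (snd p))\<^sup>2 \<partial>(M \<Otimes>\<^sub>M M)) = 0"
      by (subst integral_pair) (simp_all add: bounded_D)
    then have D0: "AE p in M \<Otimes>\<^sub>M M. D (fst p) (snd p) = 0"
      by (subst (asm) integral_nonneg_eq_0_iff_AE) (simp_all add: bounded_D)
    show "AE p in M \<Otimes>\<^sub>M M. C (fst p) (snd p) = 0"
    proof (rule AE_kernel_zero[OF bounded_C])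
      fix E F assume [measurable]: "E \<in> sets M" "F \<in> sets M"
      have ind [simp]: "bounded_measurable M (indicat_real E)" "bounded_measurable M (indicat_real F)"
        by (rule bounded_measurableI[of _ _ 1]; simp)+
      note [simp] = ind[THEN bounded_measurable_compose]
      let ?c = "\<lambda>z. \<integral>x. indicator E x * C x z \<partial>M"
      have [simp]: "bounded_measurable M ?c"
        by (rule bounded_kernel_row) simp
      have "(\<integral>z. (?c z)\<^sup>2 \<partial>M) = (\<integral>x. \<integral>y. indicator E x * indicator E y * D x y \<partial>M \<partial>M)"
        unfolding D_def by (subst integral_gram) (simp_all add: bounded_C power2_eq_square)
      also have "\<dots> = (\<integral>p. indicator E (fst p) * indicator E (snd p) * D (fst p) (snd p) \<partial>(M \<Otimes>\<^sub>M M))"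
        by (rule integral_pair[symmetric]) simp
      also have "\<dots> = 0"
        using D0 by (intro integral_eq_zero_AE) auto
      finally have c0: "AE z in M. ?c z = 0"
        by (subst (asm) integral_nonneg_eq_0_iff_AE) simp_all
      have "(\<integral>x. \<integral>y. indicator E x * indicator F y * C x y \<partial>M \<partial>M)
          = (\<integral>y. \<integral>x. indicator E x * indicator F y * C x y \<partial>M \<partial>M)"
        by (rule integral_swap) simp
      also have "\<dots> = (\<integral>y. indicator F y * ?c y \<partial>M)"
        by (simp add: mult.left_commute[of "indicator E _"] mult.assoc)
      also have "\<dots> = 0"
        using c0 by (intro integral_eq_zero_AE) auto
      finally show "(\<integral>x. \<integral>y. indicator E x * indicator F y * C x y \<partial>M \<partial>M) = 0" .
    qed
  qed
qed

end

section \<open>The function \<open>g\<close> on arguments of at least \<open>1/32\<close>\<close>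

text \<open>On the first branch both power sums are polynomials in \<open>p = z * (1 - z)\<close>.
  Comparing \<open>1 - 3 * p\<close> with \<open>8 * t = 1 - 12 * s\<close> gives
  \<open>p = 4 * s\<close>, which is substituted into the fourth power sum.\<close>

lemma g_upper_range:
  assumes "s \<ge> 0" "1/8 - 3/2 * s \<ge> 1/32"
  shows "g (1/8 - 3/2 * s) = 1/16 - s + 2 * s\<^sup>2"
proof -
  let ?t = "1/8 - 3/2 * s"
  have "?t \<in> {0<..1/8}" using assms by simp
  then obtain z where z: "z \<in> {0<..1}" "?t = 1/8 * z_power_sum 3 z"
    using bij_betw_imp_surj_on[OF z_power_sum_3_bij] by (metis (no_types, lifting) imageE)
  obtain n where n: "n \<ge> 1" "1 / (real n + 1) < z" "z \<le> 1 / real n"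
    "\<And>k. z_power_sum k z = real n * z ^ k + (1 - real n * z) ^ k"
    using z_cases[OF z(1)] by blast
  \<comment> \<open>The bound \<open>1/4\<close> is \<open>8 * 1/32\<close>; it leaves only the
    first two values of the branch index \<open>n\<close>.\<close>
  have "1/4 \<le> z_power_sum 3 z" using assms z(2) by simp
  also have "\<dots> \<le> 1 / (real n)\<^sup>2" by (rule z_power_sum_3_bounds(2)[OF n])
  finally have "(real n)\<^sup>2 \<le> 2\<^sup>2" using n(1) by (simp add: field_simps)
  then have "real n \<le> 2" by (rule power2_le_imp_le) simp
  then consider "n = 1" | "n = 2" using n(1) by linarith
  then have *: "z_power_sum k z = z ^ k + (1 - z) ^ k" if "k \<in> {3, 4}" for k
  proof cases
    case 1
    then show ?thesis using n(4) by simp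
  next
    case 2
    \<comment> \<open>The cubic power sum is strictly increasing and equals \<open>1/4\<close> at
      \<open>1/2\<close>, so only the right endpoint of the second branch remains. There
      \<open>1 - 2 * z = 0\<close>, and the formulas of both branches agree.\<close>
    have "z = 1/2"
    proof (rule ccontr)
      assume "z \<noteq> 1/2"
      then have "z < 1/2" using n(3) 2 by simp
      with z(1) have "z_power_sum 3 z < z_power_sum 3 (1/2)"
        by (intro strict_mono_onD[OF z_power_sum_3_strict_mono]) auto
      also have "\<dots> = 1/4" by (simp add: z_power_sum_def power3_eq_cube)
      finally show False using \<open>1/4 \<le> z_power_sum 3 z\<close> by simp
    qed
    then show ?thesis using that by (auto simp only: z_power_sum_def) (simp_all add: power_numeral_reduce)
  qed
  define p where "p = z * (1 - z)"
  have "z_power_sum 3 z = 1 - 3 * p" "z_power_sum 4 z = 1 - 4 * p + 2 * p\<^sup>2"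
    by (simp_all add: * p_def power_numeral_reduce algebra_simps)
  moreover from this(1) have "p = 4 * s" using z(2) by simp
  ultimately show ?thesis
    using g_eq[OF z(1)] by (subst z(2)) (simp add: power_mult_distrib)
qed

subsection \<open>Transfer to Lebesgue measure\<close>

text \<open>Preimages under \<open>f\<close> and \<open>h\<close> differ by a subset of a null set,
  which the completion measures.\<close>

lemma borel_measurable_completion_cong_AE:
  fixes f h :: "'a \<Rightarrow> real"
  assumes h: "h \<in> borel_measurable M" and eq: "AE x in M. f x = h x"
  shows "f \<in> borel_measurable (completion M)"
proof (rule measurableI)
  fix S :: "real set" assume S: "S \<in> sets borel"
  show "f -` S \<inter> space (completion M) \<in> sets (completion M)"
  proof (rule completion.in_sets_AE)
    show "h -` S \<inter> space M \<in> sets (completion M)"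
      using measurable_sets[OF h S] by (rule sets_completionI_sets)
    show "AE x in completion M. x \<in> h -` S \<inter> space M \<longleftrightarrow> x \<in> f -` S \<inter> space (completion M)"
      using AE_completion[OF eq] by eventually_elim simp
  qed simp
qed simp

lemma integral_completion_cong_AE:
  fixes f h :: "'a \<Rightarrow> real"
  assumes h: "h \<in> borel_measurable M" and eq: "AE x in M. f x = h x"
  shows "integral\<^sup>L (completion M) f = integral\<^sup>L M h"
proof -
  have "integral\<^sup>L (completion M) f = integral\<^sup>L (completion M) h"
    using borel_measurable_completion_cong_AE[OF assms] measurable_completion[OF h] AE_completion[OF eq]
    by (rule integral_cong_AE)
  also have "\<dots> = integral\<^sup>L M h" by (rule integral_completion[OF h])
  finally show ?thesis .
qed

text \<open>The two sigma-algebras coincide because the identity is measurable in both directions;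
  the measures are then compared on rectangles.\<close>

lemma pair_measure_restrict_space:
  assumes "sigma_finite_measure M" "sigma_finite_measure N"
    and [measurable]: "S \<in> sets M" "T \<in> sets N"
    and "sigma_finite_measure (restrict_space M S)" "sigma_finite_measure (restrict_space N T)"
  shows "restrict_space M S \<Otimes>\<^sub>M restrict_space N T = restrict_space (M \<Otimes>\<^sub>M N) (S \<times> T)"
    (is "?L = ?R")
proof (rule pair_measure_eqI[OF assms(5,6)])
  interpret N: sigma_finite_measure N by fact
  have space: "space ?L = space ?R"
    using assms(3,4)[THEN sets.sets_into_space]
    by (auto simp: space_pair_measure space_restrict_space)
  have sets_subset: "sets X \<subseteq> sets Y" if "(\<lambda>x. x) \<in> measurable Y X" "space X = space Y"
    for X Y :: "('a \<times> 'b) measure"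
  proof
    fix E assume E: "E \<in> sets X"
    from measurable_sets[OF that(1) this] sets.sets_into_space[OF E] that(2)
    show "E \<in> sets Y" by (simp add: Int_absorb2)
  qed
  have "(\<lambda>x. x) \<in> measurable ?R ?L"
  proof -
    have "fst \<in> measurable ?R M" "snd \<in> measurable ?R N"
      by (auto intro!: measurable_restrict_space1)
    then have "fst \<in> measurable ?R (restrict_space M S)" "snd \<in> measurable ?R (restrict_space N T)"
      by (auto intro!: measurable_restrict_space2 simp: space_restrict_space)
    from measurable_Pair[OF this] show ?thesis by simp
  qed
  moreover have "(\<lambda>x. x) \<in> measurable ?L ?R"
  proof -
    have "fst \<in> measurable ?L M" "snd \<in> measurable ?L N"
      using measurable_compose[OF measurable_fst measurable_restrict_space1[OF measurable_ident]]
        measurable_compose[OF measurable_snd measurable_restrict_space1[OF measurable_ident]]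
      by simp_all
    from measurable_Pair[OF this] have "(\<lambda>x. x) \<in> measurable ?L (M \<Otimes>\<^sub>M N)" by simp
    then show ?thesis
      by (rule measurable_restrict_space2[rotated]) (auto simp: space_pair_measure space_restrict_space)
  qed
  ultimately show sets: "sets ?L = sets ?R"
    using sets_subset space by (metis subset_antisym)
  fix A B assume AB: "A \<in> sets (restrict_space M S)" "B \<in> sets (restrict_space N T)"
  then have "A \<in> sets M" "A \<subseteq> S" "B \<in> sets N" "B \<subseteq> T"
    by (auto simp: sets_restrict_space_iff)
  then show "emeasure (restrict_space M S) A * emeasure (restrict_space N T) B = emeasure ?R (A \<times> B)"
    by (subst (1 2 3) emeasure_restrict_space) (auto simp: N.emeasure_pair_measure_Times)
qed

abbreviation unit_lborel :: "real measure" where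
  "unit_lborel \<equiv> restrict_space lborel {0..1}"

lemma prob_space_unit_lborel: "prob_space unit_lborel"
  by (rule prob_space_restrict_space) auto

lemma pair_unit_lborel:
  "unit_lborel \<Otimes>\<^sub>M unit_lborel = restrict_space lborel ({0..1} \<times> {0..1})"
  using pair_measure_restrict_space[of lborel lborel "{0..1::real}" "{0..1::real}"]
  by (simp add: lborel_prod sigma_finite_lborel prob_space_imp_sigma_finite prob_space_unit_lborel)

text \<open>Completion leaves almost-everywhere statements unchanged. This passes from the Lebesgue
  square to the product of two Borel intervals, where Fubini applies.\<close>

lemma AE_unit_square:
  "(AE p in lebesgue_on ({0..1} \<times> {0..1}). P p) \<longleftrightarrow> (AE p in unit_lborel \<Otimes>\<^sub>M unit_lborel. P p)"
proof -
  have S: "{0..1::real} \<times> {0..1::real} \<in> sets lborel"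
    by (metis borel_Times sets_lborel atLeastAtMost_borel)
  then show ?thesis
    unfolding pair_unit_lborel by (simp add: AE_restrict_space_iff AE_completion_iff)
qed

lemma borel_version:
  fixes f :: "'a::euclidean_space \<Rightarrow> real"
  assumes f: "f \<in> borel_measurable (lebesgue_on S)" and S: "S \<in> sets borel"
  obtains h where "h \<in> borel_measurable borel" "AE x in restrict_space lborel S. f x = h x"
proof -
  have "(\<lambda>x. if x \<in> S then f x else 0) \<in> borel_measurable lebesgue"
    using f S by (subst (asm) measurable_restrict_space_iff) auto
  then obtain h where "h \<in> borel_measurable lborel" "AE x in lborel. (if x \<in> S then f x else 0) = h x"
    using completion_ex_borel_measurable_real by blast
  moreover from this(2) have "AE x in restrict_space lborel S. f x = h x"
    using S by (auto simp: AE_restrict_space_iff elim!: eventually_mono)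
  ultimately show thesis using that by simp
qed

section \<open>Coordinates of product spaces and iterated cycle integrals\<close>

context prob_space
begin

lemma AE_pair_swap:
  assumes "AE p in M \<Otimes>\<^sub>M M. P p"
  shows "AE p in M \<Otimes>\<^sub>M M. P (snd p, fst p)"
proof -
  interpret P: pair_prob_space M M ..
  have swap: "(\<lambda>(x, y). (y, x)) \<in> measurable (M \<Otimes>\<^sub>M M) (M \<Otimes>\<^sub>M M)" by measurable
  have "AE p in distr (M \<Otimes>\<^sub>M M) (M \<Otimes>\<^sub>M M) (\<lambda>(x, y). (y, x)). P p"
    using assms by (subst (asm) P.distr_pair_swap)
  from AE_distrD[OF swap this] show ?thesis
    by (simp add: case_prod_beta')
qed

lemma AE_pair_fst_snd:
  assumes "AE x in M. P x"
  shows "AE p in M \<Otimes>\<^sub>M M. P (fst p) \<and> P (snd p)"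
proof -
  interpret P: pair_prob_space M M ..
  \<comment> \<open>\<open>P\<close> may fail to be measurable, so its exceptional set is enlarged
    to a measurable null set.\<close>
  obtain N where N: "N \<in> null_sets M" "{x \<in> space M. \<not> P x} \<subseteq> N"
    using assms unfolding eventually_ae_filter by blast
  then have [measurable]: "N \<in> sets M" by auto
  have "AE p in M \<Otimes>\<^sub>M M. fst p \<notin> N"
    using AE_not_in[OF N(1)] by (intro P.AE_pair_measure) auto
  from this AE_pair_swap[OF this] AE_space show ?thesis
    by eventually_elim (use N(2) in \<open>auto simp: space_pair_measure\<close>)
qed

text \<open>Two distinct coordinates are independent, so their joint law is the product measure.
  This is checked on rectangles, whose preimages are cylinders over \<open>{i, j}\<close>.\<close>

lemma AE_PiM_pair:
  assumes ij: "i \<in> I" "j \<in> I" "i \<noteq> j" and ae: "AE p in M \<Otimes>\<^sub>M M. P p"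
  shows "AE w in Pi\<^sub>M I (\<lambda>_. M). P (w i, w j)"
proof (rule AE_distrD[of "\<lambda>w. (w i, w j)"])
  show meas [measurable]: "(\<lambda>w. (w i, w j)) \<in> measurable (Pi\<^sub>M I (\<lambda>_. M)) (M \<Otimes>\<^sub>M M)"
    using ij by measurable
  have eq: "M \<Otimes>\<^sub>M M = distr (Pi\<^sub>M I (\<lambda>_. M)) (M \<Otimes>\<^sub>M M) (\<lambda>w. (w i, w j))"
  proof (rule pair_measure_eqI)
    fix A B assume AB: "A \<in> sets M" "B \<in> sets M"
    let ?X = "\<lambda>k. if k = i then A else B"
    have "emeasure (distr (Pi\<^sub>M I (\<lambda>_. M)) (M \<Otimes>\<^sub>M M) (\<lambda>w. (w i, w j))) (A \<times> B)
        = emeasure (Pi\<^sub>M I (\<lambda>_. M)) ((\<lambda>w. (w i, w j)) -` (A \<times> B) \<inter> space (Pi\<^sub>M I (\<lambda>_. M)))"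
      using AB by (intro emeasure_distr meas) auto
    also have "(\<lambda>w. (w i, w j)) -` (A \<times> B) \<inter> space (Pi\<^sub>M I (\<lambda>_. M))
        = prod_emb I (\<lambda>_. M) {i, j} (Pi\<^sub>E {i, j} ?X)"
      using ij by (auto simp: prod_emb_def space_PiM PiE_iff)
    also have "emeasure (Pi\<^sub>M I (\<lambda>_. M)) \<dots> = (\<Prod>k\<in>{i, j}. emeasure M (?X k))"
      using ij AB by (intro emeasure_PiM_emb) (auto intro: prob_space_axioms)
    finally show "emeasure M A * emeasure M B
        = emeasure (distr (Pi\<^sub>M I (\<lambda>_. M)) (M \<Otimes>\<^sub>M M) (\<lambda>w. (w i, w j))) (A \<times> B)"
      using ij by simp
  qed (auto intro: prob_space_imp_sigma_finite prob_space_axioms)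
  show "AE p in distr (Pi\<^sub>M I (\<lambda>_. M)) (M \<Otimes>\<^sub>M M) (\<lambda>w. (w i, w j)). P p"
    using ae by (subst (asm) eq)
qed

lemma integral_PiM_Suc:
  assumes "bounded_measurable (Pi\<^sub>M {..<Suc n} (\<lambda>_. M)) f"
  shows "(\<integral>w. f w \<partial>Pi\<^sub>M {..<Suc n} (\<lambda>_. M))
    = (\<integral>w. \<integral>y. f (w(n := y)) \<partial>M \<partial>Pi\<^sub>M {..<n} (\<lambda>_. M))"
proof -
  have M: "prob_space M" by (rule prob_space_axioms)
  interpret product_prob_space "\<lambda>_. M" ..
  interpret W: prob_space "Pi\<^sub>M {..<Suc n} (\<lambda>_. M)"
    by (rule prob_space_PiM[OF M])
  have "integrable (Pi\<^sub>M (insert n {..<n}) (\<lambda>_. M)) f"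
    using W.bounded_measurable_integrable[OF assms] by (simp add: lessThan_Suc)
  from product_integral_insert[OF _ _ this] show ?thesis
    by (simp add: lessThan_Suc)
qed

lemma integral_PiM_cycle3:
  assumes V: "bounded_kernel M V"
  shows "(\<integral>w. (\<Prod>i<3. V (w i) (w (Suc i mod 3))) \<partial>Pi\<^sub>M {..<3} (\<lambda>_. M))
    = (\<integral>x. \<integral>y. V x y * (\<integral>z. V y z * V z x \<partial>M) \<partial>M \<partial>M)"
proof -
  note [simp] = bounded_kernel_compose[OF V]
  have 1: "bounded_kernel M (\<lambda>x y. \<integral>z. V y z * V z x \<partial>M)"
    by (rule bounded_measurable_integral) (simp add: case_prod_beta')
  note [simp] = bounded_kernel_compose[OF this]
  have "(\<Prod>i<3. V (w i) (w (Suc i mod 3))) = V (w 0) (w 1) * (V (w 1) (w 2) * V (w 2) (w 0))" for w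
  proof -
    have "{..<3::nat} = {0, 1, 2}" by auto
    then show ?thesis by (simp flip: numeral_2_eq_2)
  qed
  then have "(\<integral>w. (\<Prod>i<3. V (w i) (w (Suc i mod 3))) \<partial>Pi\<^sub>M {..<3} (\<lambda>_. M))
      = (\<integral>w. V (w 0) (w 1) * (V (w 1) (w 2) * V (w 2) (w 0)) \<partial>Pi\<^sub>M {..<Suc 2} (\<lambda>_. M))"
    by simp
  also have "\<dots> = (\<integral>w. V (w 0) (w 1) * (\<integral>z. V (w 1) z * V z (w 0) \<partial>M) \<partial>Pi\<^sub>M {..<Suc 1} (\<lambda>_. M))"
    by (subst integral_PiM_Suc) (simp_all flip: numeral_2_eq_2)
  also have "\<dots> = (\<integral>w. \<integral>y. V (w 0) y * (\<integral>z. V y z * V z (w 0) \<partial>M) \<partial>M \<partial>Pi\<^sub>M {..<Suc 0} (\<lambda>_. M))"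
    by (subst integral_PiM_Suc) simp_all
  also have "\<dots> = (\<integral>x. \<integral>y. V x y * (\<integral>z. V y z * V z x \<partial>M) \<partial>M \<partial>M)"
    \<comment> \<open>Removing coordinate \<open>0\<close> leaves the empty index set, whose product
      is a one-point space of mass one.\<close>
    by (subst integral_PiM_Suc)
      (simp_all add: PiM_empty measure_count_space bounded_measurable_integral case_prod_beta')
  finally show ?thesis .
qed

lemma integral_PiM_cycle4:
  assumes V: "bounded_kernel M V"
  shows "(\<integral>w. (\<Prod>i<4. V (w i) (w (Suc i mod 4))) \<partial>Pi\<^sub>M {..<4} (\<lambda>_. M))
    = (\<integral>x. \<integral>y. (\<integral>z. V x z * V z y \<partial>M) * (\<integral>z. V y z * V z x \<partial>M) \<partial>M \<partial>M)"
proof -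
  note [simp] = bounded_kernel_compose[OF V]
  have 1: "bounded_kernel M (\<lambda>x y. \<integral>z. V y z * V z x \<partial>M)"
    by (rule bounded_measurable_integral) (simp add: case_prod_beta')
  note [simp] = bounded_kernel_compose[OF this]
  have "(\<Prod>i<4. V (w i) (w (Suc i mod 4)))
      = V (w 0) (w 1) * V (w 1) (w 2) * (V (w 2) (w 3) * V (w 3) (w 0))" for w
  proof -
    have "{..<4::nat} = {0, 1, 2, 3}" by auto
    then show ?thesis by (simp flip: numeral_2_eq_2)
  qed
  then have "(\<integral>w. (\<Prod>i<4. V (w i) (w (Suc i mod 4))) \<partial>Pi\<^sub>M {..<4} (\<lambda>_. M))
      = (\<integral>w. V (w 0) (w 1) * V (w 1) (w 2) * (V (w 2) (w 3) * V (w 3) (w 0)) \<partial>Pi\<^sub>M {..<Suc 3} (\<lambda>_. M))"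
    by simp
  also have "\<dots> = (\<integral>w. V (w 0) (w 1) * V (w 1) (w 2) * (\<integral>z. V (w 2) z * V z (w 0) \<partial>M) \<partial>Pi\<^sub>M {..<Suc 2} (\<lambda>_. M))"
    by (subst integral_PiM_Suc) simp_all
  also have "\<dots> = (\<integral>w. \<integral>y. V (w 0) (w 1) * V (w 1) y * (\<integral>z. V y z * V z (w 0) \<partial>M) \<partial>M \<partial>Pi\<^sub>M {..<Suc 1} (\<lambda>_. M))"
    by (subst integral_PiM_Suc) (simp_all flip: numeral_2_eq_2)
  also have "\<dots> = (\<integral>w. \<integral>u. \<integral>y. V (w 0) u * V u y * (\<integral>z. V y z * V z (w 0) \<partial>M) \<partial>M \<partial>M \<partial>Pi\<^sub>M {..<Suc 0} (\<lambda>_. M))"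
    by (subst integral_PiM_Suc) (simp_all add: bounded_measurable_integral case_prod_beta')
  also have "\<dots> = (\<integral>x. \<integral>u. \<integral>y. V x u * V u y * (\<integral>z. V y z * V z x \<partial>M) \<partial>M \<partial>M \<partial>M)"
    by (subst integral_PiM_Suc)
      (simp_all add: PiM_empty measure_count_space bounded_measurable_integral case_prod_beta')
  also have "\<dots> = (\<integral>x. \<integral>y. (\<integral>z. V x z * V z y \<partial>M) * (\<integral>z. V y z * V z x \<partial>M) \<partial>M \<partial>M)"
  \<comment> \<open>Here \<open>u\<close> is the vertex between \<open>x\<close> and
    \<open>y\<close>. Integrating it first splits the cycle at the opposite vertices
    \<open>x\<close> and \<open>y\<close> into two walks of length two.\<close>
  proof (rule Bochner_Integration.integral_cong[OF refl])
    fix x assume [simp]: "x \<in> space M"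
    have "(\<integral>u. \<integral>y. V x u * V u y * (\<integral>z. V y z * V z x \<partial>M) \<partial>M \<partial>M)
        = (\<integral>y. \<integral>u. V x u * V u y * (\<integral>z. V y z * V z x \<partial>M) \<partial>M \<partial>M)"
      by (rule integral_swap) simp
    then show "(\<integral>u. \<integral>y. V x u * V u y * (\<integral>z. V y z * V z x \<partial>M) \<partial>M \<partial>M)
        = (\<integral>y. (\<integral>z. V x z * V z y \<partial>M) * (\<integral>z. V y z * V z x \<partial>M) \<partial>M)"
      by simp
  qed
  finally show ?thesis .
qed

end

section \<open>Tournament limits as antisymmetric kernels\<close>

text \<open>For \<open>l \<ge> 2\<close> cyclically consecutive indices are distinct, so
  \<open>AE_PiM_pair\<close> applies to each factor. The finitely many exceptional null sets
  combine, and the completed integral ignores them.\<close>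

lemma cycle_density_cong_AE:
  assumes l: "l \<ge> 2" and V: "bounded_kernel unit_lborel V"
    and ae: "AE p in unit_lborel \<Otimes>\<^sub>M unit_lborel. W p = V (fst p) (snd p)"
  shows "cycle_density l W
    = (\<integral>w. (\<Prod>i<l. V (w i) (w (Suc i mod l))) \<partial>Pi\<^sub>M {..<l} (\<lambda>_. unit_lborel))"
  unfolding cycle_density_def cube_lebesgue_def
proof (rule integral_completion_cong_AE)
  interpret prob_space unit_lborel by (rule prob_space_unit_lborel)
  let ?P = "Pi\<^sub>M {..<l} (\<lambda>_. unit_lborel)"
  have mod: "Suc i mod l < l" "i \<noteq> Suc i mod l" if "i < l" for i
    using that l by (auto simp: mod_Suc)
  show "(\<lambda>w. \<Prod>i<l. V (w i) (w (Suc i mod l))) \<in> borel_measurable ?P"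
    using mod by (intro borel_measurable_prod bounded_measurable_borel[OF bounded_kernel_compose[OF V]])
      (auto intro!: measurable_component_singleton)
  have "AE w in ?P. \<forall>i\<in>{..<l}. W (w i, w (Suc i mod l)) = V (w i) (w (Suc i mod l))"
  proof (rule AE_finite_allI)
    fix i assume "i \<in> {..<l}"
    with mod AE_PiM_pair[of i "{..<l}" "Suc i mod l", OF _ _ _ ae]
    show "AE w in ?P. W (w i, w (Suc i mod l)) = V (w i) (w (Suc i mod l))" by simp
  qed simp
  then show "AE w in ?P. (\<Prod>i<l. W (w i, w (Suc i mod l))) = (\<Prod>i<l. V (w i) (w (Suc i mod l)))"
    by eventually_elim (rule prod.cong; simp)
qed

lemma tournament_limit_kernel:
  assumes W: "tournament_limit W"
  obtains A where "antisymmetric_kernel unit_lborel A" "\<And>x y. \<bar>A x y\<bar> \<le> 1/2"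
    "AE p in unit_lborel \<Otimes>\<^sub>M unit_lborel. W p = 1/2 + A (fst p) (snd p)"
proof -
  interpret prob_space unit_lborel by (rule prob_space_unit_lborel)
  have S: "{0..1::real} \<times> {0..1::real} \<in> sets borel"
    by (metis borel_Times atLeastAtMost_borel)
  obtain h where h_borel: "h \<in> borel_measurable borel"
    and h: "AE p in unit_lborel \<Otimes>\<^sub>M unit_lborel. W p = h p"
    using borel_version[OF _ S, of W] W unfolding tournament_limit_def pair_unit_lborel by blast
  \<comment> \<open>A Borel version of \<open>W\<close> has the tournament properties only almost
    everywhere. Clipping and antisymmetrizing restore the bound and the antisymmetry at every point,
    changing it only on a null set.\<close>
  define V where "V p = max 0 (min 1 (h p))" for p
  define A where "A x y = (V (x, y) - V (y, x)) / 2" for x y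
  have A: "\<bar>A x y\<bar> \<le> 1/2" for x y
    by (auto simp: A_def V_def max_def min_def)
  have [measurable]: "h \<in> borel_measurable (borel \<Otimes>\<^sub>M borel)"
    using h_borel by (simp add: borel_prod)
  have "(\<lambda>p. A (fst p) (snd p)) \<in> borel_measurable (borel \<Otimes>\<^sub>M borel)"
    unfolding A_def V_def by measurable
  then have "(\<lambda>p. A (fst p) (snd p)) \<in> borel_measurable (unit_lborel \<Otimes>\<^sub>M unit_lborel)"
    unfolding pair_unit_lborel by (intro measurable_restrict_space1) (simp add: borel_prod)
  then have bounded: "bounded_kernel unit_lborel A"
    using A by (rule bounded_measurableI)
  have anti: "A x y = - A y x" for x y by (simp add: A_def field_simps)
  have "AE p in unit_lborel \<Otimes>\<^sub>M unit_lborel. W p = 1/2 + A (fst p) (snd p)"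
    using h AE_pair_swap[OF h] AE_space
  proof eventually_elim
    case (elim p)
    define x y where "x = fst p" "y = snd p"
    have p: "p = (x, y)" by (simp add: x_y_def)
    have xy: "x \<in> {0..1}" "y \<in> {0..1}"
      using elim(3) by (auto simp: p space_pair_measure space_restrict_space)
    then have W': "W (x, y) \<in> {0..1}" "W (y, x) \<in> {0..1}" "W (x, y) + W (y, x) = 1"
      using W unfolding tournament_limit_def by blast+
    have "V (x, y) = W (x, y)" "V (y, x) = W (y, x)"
      using elim(1,2) W'(1,2) by (auto simp: p V_def)
    then show ?case using W'(3) by (simp add: p A_def field_simps)
  qed
  moreover have "antisymmetric_kernel unit_lborel A"
    using prob_space_axioms antisymmetric_kernel_axioms.intro[OF bounded anti]
    by (rule antisymmetric_kernel.intro)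
  ultimately show thesis
    using that A by blast
qed

section \<open>The function \<open>f\<close> and the equality case\<close>

lemma (in prob_space) AE_oscillation_interval:
  assumes f: "bounded_measurable M f"
    and osc: "AE p in M \<Otimes>\<^sub>M M. \<bar>f (fst p) - f (snd p)\<bar> \<le> r"
  obtains m where "AE x in M. m \<le> f x \<and> f x \<le> m + r"
proof -
  interpret P: pair_prob_space M M ..
  obtain c where c: "\<And>x. x \<in> space M \<Longrightarrow> \<bar>f x\<bar> \<le> c"
    using f unfolding bounded_measurable_def by blast
  \<comment> \<open>The supremum \<open>m\<close> of the almost-everywhere lower bounds is the
    essential infimum of \<open>f\<close>.\<close>
  define S where "S = {m. AE x in M. m \<le> f x}"
  define m where "m = Sup S"
  have "AE x in M. - c \<le> f x" using c by (intro AE_I2) force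
  then have S_ne: "S \<noteq> {}" by (auto simp: S_def)
  have "m' \<le> c" if "m' \<in> S" for m'
  proof -
    from that have "AE x in M. m' \<le> f x" by (simp add: S_def)
    with AE_space have "AE x in M. m' \<le> c"
    proof eventually_elim
      case (elim x)
      then show ?case using c[of x] by linarith
    qed
    then show ?thesis by simp
  qed
  then have S_bdd: "bdd_above S" by (rule bdd_aboveI)
  have "AE x in M. \<forall>n. m - inverse (real (Suc n)) \<le> f x"
    unfolding AE_all_countable
  proof
    fix n
    have "m - inverse (real (Suc n)) < Sup S" by (simp add: m_def)
    then obtain m' where "m' \<in> S" "m - inverse (real (Suc n)) < m'"
      using less_cSup_iff[OF S_ne S_bdd] by blast
    then show "AE x in M. m - inverse (real (Suc n)) \<le> f x"
      by (auto simp: S_def elim!: eventually_mono)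
  qed
  moreover have "AE x in M. \<forall>n. f x \<le> m + r + inverse (real (Suc n))"
    unfolding AE_all_countable
  proof
    fix n
    have "m + inverse (real (Suc n)) \<notin> S"
      using cSup_upper[OF _ S_bdd, of "m + inverse (real (Suc n))"] by (auto simp: m_def)
    then have not_AE: "\<not> (AE y in M. m + inverse (real (Suc n)) \<le> f y)" by (simp add: S_def)
    have "AE y in M. AE x in M. \<bar>f y - f x\<bar> \<le> r"
      using P.AE_pair[OF osc] by simp
    \<comment> \<open>Without such a \<open>y\<close>, the number
      \<open>m + inverse (real (Suc n))\<close> would be a lower bound almost everywhere, exceeding
      \<open>m\<close>. The row of this \<open>y\<close> then bounds \<open>f x\<close> by
      \<open>f y + r\<close>.\<close>
    then have "\<exists>y. f y < m + inverse (real (Suc n)) \<and> (AE x in M. \<bar>f y - f x\<bar> \<le> r)"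
    proof (rule contrapos_pp)
      assume "\<not> (\<exists>y. f y < m + inverse (real (Suc n)) \<and> (AE x in M. \<bar>f y - f x\<bar> \<le> r))"
      then have no: "m + inverse (real (Suc n)) \<le> f y" if "AE x in M. \<bar>f y - f x\<bar> \<le> r" for y
        using that by (meson not_le)
      show "\<not> (AE y in M. AE x in M. \<bar>f y - f x\<bar> \<le> r)"
      proof
        assume "AE y in M. AE x in M. \<bar>f y - f x\<bar> \<le> r"
        then have "AE y in M. m + inverse (real (Suc n)) \<le> f y"
          by (rule eventually_mono) (rule no)
        with not_AE show False by contradiction
      qed
    qed
    then obtain y where y: "f y < m + inverse (real (Suc n))" "AE x in M. \<bar>f y - f x\<bar> \<le> r" by blast
    from y(2) show "AE x in M. f x \<le> m + r + inverse (real (Suc n))"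
      by eventually_elim (use y(1) in linarith)
  qed
  ultimately have "AE x in M. m \<le> f x \<and> f x \<le> m + r"
  proof eventually_elim
    case (elim x)
    have "m \<le> f x + e" "f x \<le> m + r + e" if "e > 0" for e
    proof -
      obtain n where "inverse (real (Suc n)) < e" using reals_Archimedean[OF \<open>e > 0\<close>] by blast
      then show "m \<le> f x + e" "f x \<le> m + r + e"
        using elim[THEN spec, of n] by linarith+
    qed
    then show ?case by (blast intro: field_le_epsilon)
  qed
  then show thesis by (rule that)
qed

lemma borel_measurable_lebesgue_on:
  fixes f :: "'a::euclidean_space \<Rightarrow> real"
  assumes "f \<in> borel_measurable (restrict_space lborel S)" "S \<in> sets borel"
  shows "f \<in> borel_measurable (lebesgue_on S)"
  using assms by (simp add: measurable_restrict_space_iff[where c = 0] measurable_completion)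

text \<open>Integrating out \<open>y\<close> shows that \<open>a\<close> is \<open>h\<close> minus
  its mean almost everywhere; the mean cancels in \<open>a x - a y\<close>.\<close>

lemma (in antisymmetric_kernel) C_eq_0_if_difference:
  assumes h [measurable]: "h \<in> borel_measurable M" and h_bounds: "\<And>x. 0 \<le> h x \<and> h x \<le> 1/2"
    and ae: "AE p in M \<Otimes>\<^sub>M M. A (fst p) (snd p) = h (fst p) - h (snd p)"
  shows "AE p in M \<Otimes>\<^sub>M M. C (fst p) (snd p) = 0"
proof -
  interpret P: pair_prob_space M M ..
  have [simp]: "bounded_measurable M h"
    using h
  proof (rule bounded_measurableI)
    show "\<bar>h x\<bar> \<le> 1/2" for x using h_bounds[of x] by linarith
  qed
  have "AE x in M. AE y in M. A x y = h x - h y"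
    using P.AE_pair[OF ae] by simp
  with AE_space have a: "AE x in M. a x = h x - (\<integral>y. h y \<partial>M)"
  proof eventually_elim
    case (elim x)
    then have "a x = (\<integral>y. h x - h y \<partial>M)"
      unfolding a_def by (intro integral_cong_AE bounded_measurable_borel) simp_all
    then show ?case by simp
  qed
  from ae AE_pair_fst_snd[OF a] show ?thesis
    by eventually_elim (simp add: C_def)
qed

theorem corollary6:
  fixes W :: "real \<times> real \<Rightarrow> real"
  assumes "tournament_limit W"
    and "cycle_density 3 W \<ge> 1/32"
  shows "cycle_density 4 W \<ge> g (cycle_density 3 W) \<and>
    (cycle_density 4 W = g (cycle_density 3 W) \<longleftrightarrow>
      (\<exists>f :: real \<Rightarrow> real.
         f \<in> borel_measurable (lebesgue_on {0..1}) \<and>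
         (\<forall>x\<in>{0..1}. f x \<in> {0..1/2}) \<and>
         (AE (x, y) in lebesgue_on ({0..1} \<times> {0..1}). W (x, y) = 1/2 + f x - f y)))"
proof -
  obtain A where A: "antisymmetric_kernel unit_lborel A" and A_bound: "\<And>x y. \<bar>A x y\<bar> \<le> 1/2"
    and W: "AE p in unit_lborel \<Otimes>\<^sub>M unit_lborel. W p = 1/2 + A (fst p) (snd p)"
    using tournament_limit_kernel[OF assms(1)] by blast
  interpret antisymmetric_kernel unit_lborel A by fact
  let ?P = "unit_lborel \<Otimes>\<^sub>M unit_lborel"
  let ?E = "(\<integral>x. \<integral>y. (D x y)\<^sup>2 \<partial>unit_lborel \<partial>unit_lborel) + 4 * (\<integral>x. (e x)\<^sup>2 \<partial>unit_lborel)"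
  have V: "bounded_kernel unit_lborel (\<lambda>x y. 1/2 + A x y)" by simp
  have t3: "cycle_density 3 W = 1/8 - 3/2 * s"
    using cycle_density_cong_AE[OF _ V W, of 3] integral_PiM_cycle3[OF V] integral_cycle3 by simp
  have t4: "cycle_density 4 W = 1/16 - s + 2 * s\<^sup>2 + ?E"
    using cycle_density_cong_AE[OF _ V W, of 4] integral_PiM_cycle4[OF V] integral_cycle4 by simp
  have s0: "s \<ge> 0" unfolding s_def by (intro integral_nonneg_AE) simp
  have g: "g (cycle_density 3 W) = 1/16 - s + 2 * s\<^sup>2"
    using g_upper_range[OF s0] assms(2) unfolding t3 by simp
  have E0: "?E \<ge> 0" by (intro add_nonneg_nonneg mult_nonneg_nonneg integral_nonneg_AE) auto
  \<comment> \<open>The four-cycle density exceeds the value of \<open>g\<close> by exactly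
    \<open>?E\<close>, so the equality case is the vanishing of \<open>?E\<close>.\<close>
  have "?E = 0 \<longleftrightarrow> (\<exists>f :: real \<Rightarrow> real.
      f \<in> borel_measurable (lebesgue_on {0..1}) \<and>
      (\<forall>x\<in>{0..1}. f x \<in> {0..1/2}) \<and>
      (AE (x, y) in lebesgue_on ({0..1} \<times> {0..1}). W (x, y) = 1/2 + f x - f y))"
    (is "_ \<longleftrightarrow> (\<exists>f. ?R f)")
    unfolding defect_eq_0_iff
  proof
    assume C: "AE p in ?P. C (fst p) (snd p) = 0"
    \<comment> \<open>Where \<open>C\<close> vanishes, \<open>a x - a y\<close> is
      \<open>A x y\<close>, whose absolute value is at most \<open>1/2\<close>.\<close>
    then have "AE p in ?P. \<bar>a (fst p) - a (snd p)\<bar> \<le> 1/2"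
      by eventually_elim (use A_bound in \<open>simp add: C_def, metis\<close>)
    then obtain m where m: "AE x in unit_lborel. m \<le> a x \<and> a x \<le> m + 1/2"
      by (rule AE_oscillation_interval[OF bounded_a])
    \<comment> \<open>Clipping puts the values in the required interval at every point and alters
      \<open>a x - m\<close> only on a null set.\<close>
    define f where "f x = max 0 (min (1/2) (a x - m))" for x
    have [measurable]: "a \<in> borel_measurable unit_lborel"
      by (rule bounded_measurable_borel[OF bounded_a])
    have "f \<in> borel_measurable unit_lborel" unfolding f_def by measurable
    then have "f \<in> borel_measurable (lebesgue_on {0..1})"
      by (rule borel_measurable_lebesgue_on) simp
    moreover have "\<forall>x\<in>{0..1}. f x \<in> {0..1/2}" by (auto simp: f_def max_def min_def)
    moreover have "AE p in ?P. W p = 1/2 + f (fst p) - f (snd p)"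
      using W C AE_pair_fst_snd[OF m]
      by eventually_elim (auto simp: C_def f_def)
    ultimately show "\<exists>f. ?R f"
      unfolding AE_unit_square by (auto simp: case_prod_beta')
  next
    assume "\<exists>f. ?R f"
    then obtain f where f: "f \<in> borel_measurable (lebesgue_on {0..1})" "\<And>x. x \<in> {0..1} \<Longrightarrow> f x \<in> {0..1/2}"
      "AE p in ?P. W p = 1/2 + f (fst p) - f (snd p)"
      unfolding AE_unit_square by (auto simp: case_prod_beta')
    obtain h where h [measurable]: "h \<in> borel_measurable borel" and fh: "AE x in unit_lborel. f x = h x"
      using borel_version[OF f(1)] by auto
    \<comment> \<open>Clipping the Borel version gives bounds everywhere; it still equals
      \<open>f\<close> almost everywhere because \<open>f\<close> already takes values in that
      interval.\<close>
    define h' where "h' x = max 0 (min (1/2) (h x))" for x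
    have "AE x in unit_lborel. f x = h' x"
      using fh AE_space
    proof eventually_elim
      case (elim x)
      then have "f x \<in> {0..1/2}" by (intro f(2)) (simp add: space_restrict_space)
      then show ?case using elim(1) by (simp add: h'_def)
    qed
    from W f(3) AE_pair_fst_snd[OF this]
    have "AE p in ?P. A (fst p) (snd p) = h' (fst p) - h' (snd p)"
      by eventually_elim simp
    moreover have "h' \<in> borel_measurable unit_lborel"
      unfolding h'_def by (intro measurable_restrict_space1) simp
    ultimately show "AE p in ?P. C (fst p) (snd p) = 0"
      by (intro C_eq_0_if_difference[of h']) (auto simp: h'_def)
  qed
  moreover have "cycle_density 4 W = g (cycle_density 3 W) \<longleftrightarrow> ?E = 0"
    "cycle_density 4 W \<ge> g (cycle_density 3 W)"
    using E0 unfolding g t4 by linarith+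
  ultimately show ?thesis by (simp only: simp_thms)
qed

end
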